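(* Let $f\in C(K)$. Then $$\lim_{n\to\infty}F_n^{(\alpha,\beta)}(f;\mathbf{s})=f(\mathbf{s})$$ uniformly for $\mathbf{s}\in K$.
   Context: Sigmoidal function. A measurable function $\eta:\mathbb{R}\to\mathbb{R}$ is sigmoidal if $\lim_{s\to-\infty}\eta(s)=0$ and $\lim_{s\to+\infty}\eta(s)=1$. Throughout, $\eta$ is an increasing sigmoidal function with $\eta(1)<1$ such that: (a) $\eta(s)-\tfrac12$ is an odd function of $s$; (b) $\eta\in C^2(\mathbb{R})$ and $\eta$ is concave on $[0,+\infty)$; (c) there exists $\rho>0$ such that $\eta(s)=\mathcal{O}(|s|^{-1-\rho})$ as $s\to-\infty$. Activation functions. Put $\sigma_\eta(s):=\frac12[\eta(s+1)-\eta(s-1)]$ for $s\in\mathbb{R}$, and $\sigma(\mathbf{s})=\prod_{i=1}^d\sigma_\eta(s_i)$ for $\mathbf{s}=(s_1,\dots,s_d)\in\mathbb{R}^d$, $d\ge1$. Operators. Let $K=\prod_{i=1}^d[a_i,b_i]\subset\mathbb{R}^d$ be a compact rectangular domain, and let $0\le\alpha\le\beta$ be fixed. For $n\in\mathbb{N}$ put $\Lambda_n=\{\mathbf{k}=(k_1,\dots,k_d)\in\mathbb{Z}^d:\lceil na_i\rceil\le k_i\le\lfloor nb_i\rfloor,\ i=1,\dots,d\}$, and for $\mathbf{k}\in\Lambda_n$ put $$\mathbf{s}_{\mathbf{k},n}^{\alpha,\beta}=\left(\frac{k_1+\alpha}{n+\beta},\dots,\frac{k_d+\alpha}{n+\beta}\right).$$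 $C(K)$ is the space of real-valued continuous functions on $K$. For $f\in C(K)$, the multivariate Stancu-type neural network operators are $$F_n^{(\alpha,\beta)}(f;\mathbf{s})=\frac{\sum_{\mathbf{k}\in\Lambda_n}\sigma(n\mathbf{s}-\mathbf{k})\,f(\mathbf{s}_{\mathbf{k},n}^{\alpha,\beta})}{\sum_{\mathbf{k}\in\Lambda_n}\sigma(n\mathbf{s}-\mathbf{k})},\qquad\mathbf{s}\in K.$$ Convention. Since the nodes $\mathbf{s}_{\mathbf{k},n}^{\alpha,\beta}$ may lie outside $K$, whenever $f\in C(K)$ appears in the operators one fixes a bounded continuous extension of $f$ to a neighbourhood of $K$ containing all the nodes that occur, and this extension is still denoted by $f$. *)

theory Defs
  imports "HOL-Analysis.Analysis" "HOL-Library.Landau_Symbols"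
begin

definition sigmoidal :: "(real \<Rightarrow> real) \<Rightarrow> bool" where
  "sigmoidal \<eta> \<longleftrightarrow>
     \<eta> \<in> borel_measurable borel \<and> (\<eta> \<longlongrightarrow> 0) at_bot \<and> (\<eta> \<longlongrightarrow> 1) at_top"

definition C2_on_reals :: "(real \<Rightarrow> real) \<Rightarrow> bool" where
  "C2_on_reals \<eta> \<longleftrightarrow>
     (\<exists>\<eta>' \<eta>''. (\<forall>s. (\<eta> has_real_derivative \<eta>' s) (at s)) \<and>
              (\<forall>s. (\<eta>' has_real_derivative \<eta>'' s) (at s)) \<and>
              continuous_on UNIV \<eta>'')"

definition sigma1 :: "(real \<Rightarrow> real) \<Rightarrow> real \<Rightarrow> real" where
  "sigma1 \<eta> s = (1/2) * (\<eta> (s + 1) - \<eta> (s - 1))"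

definition sigma :: "(real \<Rightarrow> real) \<Rightarrow> real ^ 'd \<Rightarrow> real" where
  "sigma \<eta> s = (\<Prod>i\<in>UNIV. sigma1 \<eta> (s $ i))"

definition Lambda :: "real ^ 'd \<Rightarrow> real ^ 'd \<Rightarrow> nat \<Rightarrow> (int ^ 'd) set" where
  "Lambda a b n = {k. \<forall>i. \<lceil>real n * a $ i\<rceil> \<le> k $ i \<and> k $ i \<le> \<lfloor>real n * b $ i\<rfloor>}"

lemma finite_Lambda: "finite (Lambda a b n)"
proof -
  let ?J = "\<lambda>i. {\<lceil>real n * a $ i\<rceil>..\<lfloor>real n * b $ i\<rfloor>}"
  have "finite (vec_lambda ` Pi\<^sub>E UNIV ?J)"
    by (intro finite_imageI finite_PiE) auto
  moreover have "Lambda a b n \<subseteq> vec_lambda ` Pi\<^sub>E UNIV ?J"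
  proof
    fix k assume "k \<in> Lambda a b n"
    then have "vec_nth k \<in> Pi\<^sub>E UNIV ?J"
      by (auto simp: Lambda_def)
    then have "vec_lambda (vec_nth k) \<in> vec_lambda ` Pi\<^sub>E UNIV ?J"
      by (rule imageI)
    then show "k \<in> vec_lambda ` Pi\<^sub>E UNIV ?J"
      by simp
  qed
  ultimately show ?thesis
    by (rule finite_subset[rotated])
qed

definition stancu_node :: "real \<Rightarrow> real \<Rightarrow> nat \<Rightarrow> int ^ 'd \<Rightarrow> real ^ 'd" where
  "stancu_node \<alpha> \<beta> n k = (\<chi> i. (of_int (k $ i) + \<alpha>) / (real n + \<beta>))"

definition stancu_weight :: "(real \<Rightarrow> real) \<Rightarrow> nat \<Rightarrow> int ^ 'd \<Rightarrow> real ^ 'd \<Rightarrow> real" where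
  "stancu_weight \<eta> n k s = sigma \<eta> (real n *\<^sub>R s - (\<chi> i. of_int (k $ i)))"

text \<open>If \<open>Lambda a b n\<close> is empty, the quotient below is \<open>0 / 0 = 0\<close>; when \<open>a $ i < b $ i\<close> for
  all \<open>i\<close>, this happens for only finitely many \<open>n\<close>.\<close>

definition stancu_nn ::
  "(real \<Rightarrow> real) \<Rightarrow> real \<Rightarrow> real \<Rightarrow> real ^ 'd \<Rightarrow> real ^ 'd \<Rightarrow> nat
     \<Rightarrow> (real ^ 'd \<Rightarrow> real) \<Rightarrow> real ^ 'd \<Rightarrow> real" where
  "stancu_nn \<eta> \<alpha> \<beta> a b n f s =
     (\<Sum>k\<in>Lambda a b n. stancu_weight \<eta> n k s * f (stancu_node \<alpha> \<beta> n k)) /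
     (\<Sum>k\<in>Lambda a b n. stancu_weight \<eta> n k s)"

text \<open>\<open>g\<close> is a bounded continuous extension of \<open>f\<close> from the box \<open>cbox a b\<close> to a neighbourhood \<open>V\<close>
  of the box containing all nodes. The index \<open>n = 0\<close> is excluded: there the nodes
  would have denominator \<open>\<beta>\<close>, possibly \<open>0\<close>.\<close>

definition stancu_extension ::
  "real \<Rightarrow> real \<Rightarrow> real ^ 'd \<Rightarrow> real ^ 'd \<Rightarrow> (real ^ 'd \<Rightarrow> real) \<Rightarrow> (real ^ 'd \<Rightarrow> real) \<Rightarrow> bool" where
  "stancu_extension \<alpha> \<beta> a b f g \<longleftrightarrow>
     (\<exists>V. cbox a b \<subseteq> interior V \<and>
          (\<forall>n\<ge>1. \<forall>k\<in>Lambda a b n. stancu_node \<alpha> \<beta> n k \<in> V) \<and>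
          continuous_on V g \<and> bounded (g ` V) \<and> (\<forall>s\<in>cbox a b. g s = f s))"

end

theory Submission
  imports Defs
begin

text \<open>The numerator of \<open>F\<^sub>n g s - f s\<close> is split according to whether every coordinate of
  \<open>k\<close> lies within \<open>n \<delta>\<close> of \<open>n s\<close>. For such \<open>k\<close> the node is close to \<open>s\<close>, so uniform
  continuity makes this part a small multiple of the denominator. The
  remaining part factorises over the coordinates, and in one coordinate the sum of
  \<open>\<sigma>\<^sub>\<eta> (x - k)\<close> over integers telescopes: it is at most \<open>1\<close> in total and at most
  \<open>2 (1 - \<eta> (T - 1))\<close> over \<open>|x - k| > T\<close>. Finally, the denominator is bounded below by a
  single term whose index is within \<open>1\<close> of \<open>n s\<close> in every coordinate, and \<open>\<sigma>\<^sub>\<eta>\<close> is bounded below on \<open>[-1, 1]\<close>.\<close>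

section \<open>Uniform continuity near a compact set, and sums over integer boxes\<close>

text \<open>Nodes may leave the box, so only one of the two points is taken from the compact set
  \<open>K\<close>. Continuity at each point of \<open>K\<close> with tolerance \<open>e/2\<close>
  gives an open cover by balls; with a Lebesgue number \<open>d\<close> of this cover,
  \<open>s\<close> and \<open>x\<close> share one ball and are both compared with its
  centre.\<close>

lemma compact_uniformly_continuous_near:
  fixes g :: "'a::metric_space \<Rightarrow> 'b::metric_space"
  assumes "compact K" "K \<subseteq> V" "continuous_on V g" "0 < e"
  obtains d where "0 < d" "\<And>s x. s \<in> K \<Longrightarrow> x \<in> V \<Longrightarrow> dist x s < d \<Longrightarrow> dist (g x) (g s) < e"
proof -
  have "\<forall>s\<in>K. \<exists>d>0. \<forall>x\<in>V. dist x s < d \<longrightarrow> dist (g x) (g s) < e/2"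
    using assms(2-4) unfolding continuous_on_iff by (meson half_gt_zero subsetD)
  then obtain r where r: "\<And>s. s \<in> K \<Longrightarrow> 0 < r s"
    "\<And>s x. s \<in> K \<Longrightarrow> x \<in> V \<Longrightarrow> dist x s < r s \<Longrightarrow> dist (g x) (g s) < e/2"
    by metis
  have "K \<subseteq> \<Union>((\<lambda>s. ball s (r s)) ` K)"
    using r(1) by auto
  then obtain d where d: "0 < d" "\<And>x. x \<in> K \<Longrightarrow> \<exists>G\<in>(\<lambda>s. ball s (r s)) ` K. ball x d \<subseteq> G"
    by (rule Heine_Borel_lemma[OF \<open>compact K\<close>]) auto
  show thesis
  proof
    fix s x assume s: "s \<in> K" and x: "x \<in> V" "dist x s < d"
    obtain t where t: "t \<in> K" "ball s d \<subseteq> ball t (r t)"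
      using d(2)[OF s] by auto
    have "s \<in> ball t (r t)" "x \<in> ball t (r t)"
      using x(2) d(1) by (intro subsetD[OF t(2)]; simp add: dist_commute)+
    then have "dist s t < r t" "dist x t < r t"
      by (simp_all add: dist_commute)
    then have "dist (g x) (g t) < e/2" "dist (g s) (g t) < e/2"
      using r(2)[OF t(1)] s x(1) assms(2) by blast+
    then show "dist (g x) (g s) < e"
      by (rule dist_triangle_half_l)
  qed (rule d(1))
qed

text \<open>Distributivity of products over sums, with the choice functions of
  \<open>prod_sum_PiE\<close> transported to vectors by \<open>vec_lambda\<close>.\<close>

lemma sum_prod_vec:
  fixes F :: "'d::finite \<Rightarrow> 'b \<Rightarrow> 'c::comm_semiring_1"
  assumes "\<And>i. finite (J i)"
  shows "(\<Sum>k | \<forall>i. k $ i \<in> J i. \<Prod>i\<in>UNIV. F i (k $ i)) = (\<Prod>i\<in>UNIV. \<Sum>j\<in>J i. F i j)"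
proof -
  have "(\<Prod>i\<in>UNIV. \<Sum>j\<in>J i. F i j) = (\<Sum>k\<in>Pi\<^sub>E UNIV J. \<Prod>i\<in>UNIV. F i (k i))"
    using assms by (intro prod_sum_PiE) auto
  also have "\<dots> = (\<Sum>k | \<forall>i. k $ i \<in> J i. \<Prod>i\<in>UNIV. F i (k $ i))"
    by (rule sum.reindex_bij_witness[where i = vec_nth and j = vec_lambda]) auto
  finally show ?thesis ..
qed

section \<open>Elementary bounds and one-dimensional sums of \<open>sigma1\<close>\<close>

lemma sigmoidal_bounds:
  assumes "sigmoidal \<eta>" "mono \<eta>"
  shows "0 \<le> \<eta> s" "\<eta> s \<le> 1"
proof -
  have "eventually (\<lambda>x. \<eta> x \<le> \<eta> s) at_bot" "eventually (\<lambda>x. \<eta> s \<le> \<eta> x) at_top"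
    using monoD[OF assms(2)] by (auto simp: eventually_at_bot_linorder eventually_at_top_linorder)
  then show "0 \<le> \<eta> s" "\<eta> s \<le> 1"
    using assms(1) unfolding sigmoidal_def
    by (auto intro: tendsto_upperbound tendsto_lowerbound)
qed

lemma sigma1_nonneg: "mono \<eta> \<Longrightarrow> 0 \<le> sigma1 \<eta> s"
  by (simp add: sigma1_def monoD)

lemma stancu_weight_eq: "stancu_weight \<eta> n k s = (\<Prod>i\<in>UNIV. sigma1 \<eta> (real n * s $ i - of_int (k $ i)))"
  by (simp add: stancu_weight_def sigma_def)

lemma stancu_weight_nonneg: "mono \<eta> \<Longrightarrow> 0 \<le> stancu_weight \<eta> n k s"
  by (simp add: stancu_weight_eq prod_nonneg sigma1_nonneg)

text \<open>Each summand is half a difference of values at distance two, so two values survive at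
  either end. The case \<open>m = p + 1\<close> is the empty sum, where the four values cancel; it
  starts the induction.\<close>

lemma sum_sigma1_telescope:
  assumes "m \<le> p + 1"
  shows "(\<Sum>k=m..p. sigma1 \<eta> (x - of_int k)) =
    (\<eta> (x - of_int m + 1) + \<eta> (x - of_int m) - \<eta> (x - of_int p) - \<eta> (x - of_int p - 1)) / 2"
  using assms
proof (induction "p + 1" arbitrary: p rule: int_ge_induct)
  case base
  then have "m = p + 1" by simp
  then show ?case by (simp add: algebra_simps)
next
  case (step q)
  then have "p = q" "m \<le> p" by auto
  then have "{m..p} = insert p {m..p - 1}" by auto
  moreover have "(\<Sum>k=m..p-1. sigma1 \<eta> (x - of_int k)) =
    (\<eta> (x - of_int m + 1) + \<eta> (x - of_int m) - \<eta> (x - of_int (p-1)) - \<eta> (x - of_int (p-1) - 1)) / 2"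
    using step.hyps(2)[of "p - 1"] \<open>p = q\<close> by simp
  ultimately show ?case
    by (simp add: sigma1_def field_simps)
qed

lemma sum_sigma1_le_1:
  assumes "sigmoidal \<eta>" "mono \<eta>"
  shows "(\<Sum>k=m..p. sigma1 \<eta> (x - of_int k)) \<le> 1"
proof (cases "m \<le> p + 1")
  case True
  then show ?thesis
    using sigmoidal_bounds(2)[OF assms, of "x - of_int m + 1"] sigmoidal_bounds(2)[OF assms, of "x - of_int m"]
      sigmoidal_bounds(1)[OF assms, of "x - of_int p"] sigmoidal_bounds(1)[OF assms, of "x - of_int p - 1"]
    by (simp add: sum_sigma1_telescope)
qed simp

text \<open>Filling the gaps of \<open>A\<close> up to the interval from \<open>Min A\<close> to
  \<open>Max A\<close> adds only nonnegative terms. Since \<open>Max A\<close> lies in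
  \<open>A\<close>, the two values subtracted after telescoping are at least
  \<open>\<eta> (T - 1)\<close>, while the other two are at most \<open>1\<close>.\<close>

lemma sum_sigma1_right_tail:
  assumes "sigmoidal \<eta>" "mono \<eta>" "finite A" "\<And>k. k \<in> A \<Longrightarrow> T < x - of_int k"
  shows "(\<Sum>k\<in>A. sigma1 \<eta> (x - of_int k)) \<le> 1 - \<eta> (T - 1)"
proof (cases "A = {}")
  case True
  then show ?thesis using sigmoidal_bounds[OF assms(1,2)] by simp
next
  case False
  let ?m = "Min A" and ?p = "Max A"
  have mp: "?m \<le> ?p + 1"
    using assms(3) False by (smt (verit) Max_ge Min_in)
  have "(\<Sum>k\<in>A. sigma1 \<eta> (x - of_int k)) \<le> (\<Sum>k=?m..?p. sigma1 \<eta> (x - of_int k))"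
    using assms False by (intro sum_mono2) (auto intro: sigma1_nonneg)
  also have "\<dots> =
    (\<eta> (x - of_int ?m + 1) + \<eta> (x - of_int ?m) - \<eta> (x - of_int ?p) - \<eta> (x - of_int ?p - 1)) / 2"
    by (rule sum_sigma1_telescope[OF mp])
  also have "\<dots> \<le> 1 - \<eta> (T - 1)"
  proof -
    have "T < x - of_int ?p"
      using assms(3,4) False by simp
    then have "\<eta> (T - 1) \<le> \<eta> (x - of_int ?p)" "\<eta> (T - 1) \<le> \<eta> (x - of_int ?p - 1)"
      by (auto intro!: monoD[OF assms(2)])
    moreover have "\<eta> (x - of_int ?m + 1) \<le> 1" "\<eta> (x - of_int ?m) \<le> 1"
      using sigmoidal_bounds[OF assms(1,2)] by auto
    ultimately show ?thesis by (simp add: field_simps)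
  qed
  finally show ?thesis .
qed

text \<open>The symmetry of \<open>\<eta>\<close> makes \<open>sigma1 \<eta>\<close> even, so
  negating both \<open>x\<close> and \<open>k\<close> turns the left tail into a right tail.\<close>

lemma sum_sigma1_tails:
  assumes "sigmoidal \<eta>" "mono \<eta>" and sym: "\<And>s. \<eta> (- s) = 1 - \<eta> s"
    and "finite A" "\<And>k. k \<in> A \<Longrightarrow> T < \<bar>x - of_int k\<bar>"
  shows "(\<Sum>k\<in>A. sigma1 \<eta> (x - of_int k)) \<le> 2 * (1 - \<eta> (T - 1))"
proof -
  let ?R = "{k\<in>A. T < x - of_int k}" and ?L = "{k\<in>A. \<not> T < x - of_int k}"
  have even: "sigma1 \<eta> (- s) = sigma1 \<eta> s" for s
  proof -
    have "- s + 1 = - (s - 1)" "- s - 1 = - (s + 1)" by simp_all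
    then show ?thesis unfolding sigma1_def by (simp only: sym) simp
  qed
  have "(\<Sum>k\<in>?L. sigma1 \<eta> (x - of_int k)) = (\<Sum>k\<in>?L. sigma1 \<eta> (- x - of_int (- k)))"
    by (rule sum.cong[OF refl]) (subst even[symmetric], simp)
  also have "\<dots> = (\<Sum>k\<in>uminus ` ?L. sigma1 \<eta> (- x - of_int k))"
    by (simp add: sum.reindex)
  also have "\<dots> \<le> 1 - \<eta> (T - 1)"
    using assms(4,5) by (intro sum_sigma1_right_tail assms(1,2)) (auto dest!: assms(5))
  finally have "(\<Sum>k\<in>?L. sigma1 \<eta> (x - of_int k)) \<le> 1 - \<eta> (T - 1)" .
  moreover have "(\<Sum>k\<in>?R. sigma1 \<eta> (x - of_int k)) \<le> 1 - \<eta> (T - 1)"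
    using assms(4) by (intro sum_sigma1_right_tail assms(1,2)) auto
  moreover have "(\<Sum>k\<in>A. sigma1 \<eta> (x - of_int k)) =
      (\<Sum>k\<in>?R. sigma1 \<eta> (x - of_int k)) + (\<Sum>k\<in>?L. sigma1 \<eta> (x - of_int k))"
    using assms(4) by (subst sum.union_disjoint[symmetric]) (auto intro: sum.cong)
  ultimately show ?thesis by (simp only: mult_2 add_mono)
qed

section \<open>Lower bound for the denominator\<close>

text \<open>Concavity forbids a flat start: the graph at \<open>1\<close> lies above the chord from
  \<open>0\<close> to some \<open>t \<ge> 1\<close> with \<open>\<eta> t > 1/2\<close>. The strict
  inequality keeps the lower bound for the denominator positive.\<close>

lemma half_less_eta_1:
  assumes "sigmoidal \<eta>" "concave_on {0..} \<eta>" "\<eta> 0 = 1/2"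
  shows "1/2 < \<eta> (1::real)"
proof -
  have "eventually (\<lambda>x. 1/2 < \<eta> x) at_top"
    using assms(1) unfolding sigmoidal_def by (intro order_tendstoD(1)[where y = 1]) auto
  then obtain t where t: "1/2 < \<eta> t" "1 \<le> t"
    by (metis eventually_at_top_linorder nle_le)
  have "convex_on {0..} (\<lambda>x. - \<eta> x)"
    using assms(2) by (simp add: concave_on_def)
  \<comment> \<open>The point \<open>1\<close> is the convex combination of \<open>0\<close> and
    \<open>t\<close> in which \<open>t\<close> has weight \<open>1/t\<close>.\<close>
  then have "- \<eta> ((1 - 1/t) *\<^sub>R 0 + (1/t) *\<^sub>R t) \<le> (1 - 1/t) * (- \<eta> 0) + (1/t) * (- \<eta> t)"
    using t(2) by (intro convex_onD) auto
  then have "1/2 + (\<eta> t - 1/2) / t \<le> \<eta> 1"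
    using t assms(3) by (simp add: field_simps)
  moreover have "0 < (\<eta> t - 1/2) / t"
    using t by simp
  ultimately show ?thesis by linarith
qed

text \<open>The arguments \<open>x + 1\<close> and \<open>x - 1\<close> lie on either side of
  \<open>0\<close>, and one of them has modulus at least \<open>1\<close>. By symmetry the
  increments of \<open>\<eta>\<close> over [0, 1] and over [-1, 0] are both
  \<open>\<eta> 1 - 1/2\<close>.\<close>

lemma sigma1_lower_bound:
  assumes "mono \<eta>" and sym: "\<And>s. \<eta> (- s) = 1 - \<eta> s" and "\<bar>x\<bar> \<le> 1"
  shows "(\<eta> 1 - 1/2) / 2 \<le> sigma1 \<eta> x"
proof (cases "0 \<le> x")
  case True
  then have "\<eta> 1 \<le> \<eta> (x + 1)" "\<eta> (x - 1) \<le> \<eta> 0"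
    using assms(3) by (auto intro!: monoD[OF assms(1)])
  then show ?thesis using sym[of 0] by (simp add: sigma1_def)
next
  case False
  then have "\<eta> 0 \<le> \<eta> (x + 1)" "\<eta> (x - 1) \<le> \<eta> (- 1)"
    using assms(3) by (auto intro!: monoD[OF assms(1)])
  then show ?thesis using sym[of 0] sym[of 1] by (simp add: sigma1_def)
qed

text \<open>Rounding \<open>y\<close> up works unless it overshoots \<open>v\<close>; in that case
  the length of the interval, at least \<open>1\<close>, leaves room to round down. This supplies
  each coordinate of an index near \<open>n s\<close>.\<close>

lemma ex_int_near_in_interval:
  fixes u v y :: real
  assumes "u + 1 \<le> v" "u \<le> y" "y \<le> v"
  shows "\<exists>k. \<lceil>u\<rceil> \<le> k \<and> k \<le> \<lfloor>v\<rfloor> \<and> \<bar>y - of_int k\<bar> \<le> 1"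
proof (cases "\<lceil>y\<rceil> \<le> \<lfloor>v\<rfloor>")
  case True
  moreover from assms have "\<lceil>u\<rceil> \<le> \<lceil>y\<rceil>" "\<bar>y - of_int \<lceil>y\<rceil>\<bar> \<le> 1"
    by linarith+
  ultimately show ?thesis by blast
next
  case False
  then have "v < of_int \<lceil>y\<rceil>"
    by (simp only: not_le floor_less_iff)
  with assms(1) ceiling_diff_floor_le_1[of y] have "u \<le> of_int \<lfloor>y\<rfloor>"
    by linarith
  then have "\<lceil>u\<rceil> \<le> \<lfloor>y\<rfloor>"
    by (rule ceiling_le)
  moreover have "\<lfloor>y\<rfloor> \<le> \<lfloor>v\<rfloor>"
    using assms(3) by (rule floor_mono)
  moreover have "\<bar>y - of_int \<lfloor>y\<rfloor>\<bar> \<le> 1"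
    by linarith
  ultimately show ?thesis by blast
qed

text \<open>The bound depends neither on \<open>n\<close> nor on \<open>s\<close>, as uniform
  convergence requires.\<close>

lemma stancu_denominator_lower_bound:
  fixes a b s :: "real ^ 'd"
  assumes "mono \<eta>" and sym: "\<And>s. \<eta> (- s) = 1 - \<eta> s" and "1/2 \<le> \<eta> 1"
    and ab: "\<And>i. 1 \<le> real n * (b $ i - a $ i)" and s: "s \<in> cbox a b"
  shows "((\<eta> 1 - 1/2) / 2) ^ CARD('d) \<le> (\<Sum>k\<in>Lambda a b n. stancu_weight \<eta> n k s)"
proof -
  have "\<exists>k. \<lceil>real n * a $ i\<rceil> \<le> k \<and> k \<le> \<lfloor>real n * b $ i\<rfloor> \<and> \<bar>real n * s $ i - of_int k\<bar> \<le> 1" for i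
    using s ab[of i]
    by (intro ex_int_near_in_interval) (auto simp: mem_box_cart algebra_simps intro: mult_left_mono)
  then obtain k where k: "\<And>i. \<lceil>real n * a $ i\<rceil> \<le> k i \<and> k i \<le> \<lfloor>real n * b $ i\<rfloor> \<and> \<bar>real n * s $ i - of_int (k i)\<bar> \<le> 1"
    by metis
  have "((\<eta> 1 - 1/2) / 2) ^ CARD('d) = (\<Prod>i\<in>(UNIV::'d set). (\<eta> 1 - 1/2) / 2)"
    by simp
  also have "\<dots> \<le> stancu_weight \<eta> n (vec_lambda k) s"
    unfolding stancu_weight_eq using k assms(3)
    by (intro prod_mono conjI sigma1_lower_bound assms(1,2)) auto
  also have "\<dots> \<le> (\<Sum>k\<in>Lambda a b n. stancu_weight \<eta> n k s)"
    using k by (intro member_le_sum finite_Lambda stancu_weight_nonneg assms(1)) (auto simp: Lambda_def)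
  finally show ?thesis .
qed

section \<open>Total weight of the far indices\<close>

text \<open>A union bound over the coordinates: when one fixed coordinate is far, the sum factorises
  into one tail and full sums that are at most \<open>1\<close>.\<close>

lemma stancu_weight_far_sum:
  fixes a b s :: "real ^ 'd"
  assumes "sigmoidal \<eta>" "mono \<eta>" and sym: "\<And>s. \<eta> (- s) = 1 - \<eta> s"
  shows "(\<Sum>k | k \<in> Lambda a b n \<and> (\<exists>i. T < \<bar>real n * s $ i - of_int (k $ i)\<bar>). stancu_weight \<eta> n k s)
    \<le> real CARD('d) * (2 * (1 - \<eta> (T - 1)))"
proof -
  let ?I = "\<lambda>i. {\<lceil>real n * a $ i\<rceil>..\<lfloor>real n * b $ i\<rfloor>}"
  let ?far = "\<lambda>i j. T < \<bar>real n * s $ i - of_int j\<bar>"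
  let ?S = "\<lambda>i A. \<Sum>j\<in>A. sigma1 \<eta> (real n * s $ i - of_int j)"
  have coord: "(\<Sum>k | k \<in> Lambda a b n \<and> ?far i (k $ i). stancu_weight \<eta> n k s) \<le> 2 * (1 - \<eta> (T - 1))" for i
  proof -
    \<comment> \<open>Only the range of coordinate \<open>i\<close> shrinks, so the index set is
      still a product and \<open>sum_prod_vec\<close> applies.\<close>
    let ?J = "?I(i := {j \<in> ?I i. ?far i j})"
    have fin: "finite (?J l)" for l
      by (rule finite_subset[of _ "?I l"]) (auto split: if_splits)
    have "{k. k \<in> Lambda a b n \<and> ?far i (k $ i)} = {k. \<forall>l. k $ l \<in> ?J l}"
      by (auto simp: Lambda_def split: if_splits)
    then have "(\<Sum>k | k \<in> Lambda a b n \<and> ?far i (k $ i). stancu_weight \<eta> n k s) =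
        (\<Sum>k | \<forall>l. k $ l \<in> ?J l. \<Prod>l\<in>UNIV. sigma1 \<eta> (real n * s $ l - of_int (k $ l)))"
      by (simp only: stancu_weight_eq)
    also have "\<dots> = (\<Prod>l\<in>UNIV. ?S l (?J l))"
      by (rule sum_prod_vec[OF fin])
    also have "\<dots> = ?S i (?J i) * (\<Prod>l\<in>UNIV - {i}. ?S l (?J l))"
      by (rule prod.remove) auto
    also have "\<dots> \<le> 2 * (1 - \<eta> (T - 1)) * 1"
    proof (rule mult_mono)
      show "?S i (?J i) \<le> 2 * (1 - \<eta> (T - 1))"
        by (rule sum_sigma1_tails[OF assms fin[of i]]) simp
      show "(\<Prod>l\<in>UNIV - {i}. ?S l (?J l)) \<le> 1"
        by (rule prod_le_1)
          (auto intro!: sum_nonneg sigma1_nonneg sum_sigma1_le_1 assms(1,2) simp del: atLeastAtMost_iff)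
      show "0 \<le> 2 * (1 - \<eta> (T - 1))"
        using sigmoidal_bounds(2)[OF assms(1,2)] by simp
      show "0 \<le> (\<Prod>l\<in>UNIV - {i}. ?S l (?J l))"
        by (intro prod_nonneg ballI sum_nonneg sigma1_nonneg assms(2))
    qed
    finally show ?thesis by simp
  qed
  let ?w = "\<lambda>k. stancu_weight \<eta> n k s"
  have "(\<Sum>k | k \<in> Lambda a b n \<and> (\<exists>i. ?far i (k $ i)). ?w k)
      = (\<Sum>k\<in>Lambda a b n. if \<exists>i. ?far i (k $ i) then ?w k else 0)"
    by (rule sum.inter_filter[OF finite_Lambda])
  \<comment> \<open>An index far in several coordinates is counted once for each of them, which is
    harmless because weights are nonnegative.\<close>
  also have "\<dots> \<le> (\<Sum>k\<in>Lambda a b n. \<Sum>i\<in>UNIV. if ?far i (k $ i) then ?w k else 0)"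
  proof (rule sum_mono)
    fix k
    have w: "0 \<le> ?w k" by (rule stancu_weight_nonneg[OF assms(2)])
    show "(if \<exists>i. ?far i (k $ i) then ?w k else 0) \<le> (\<Sum>i\<in>UNIV. if ?far i (k $ i) then ?w k else 0)"
    proof (cases "\<exists>i. ?far i (k $ i)")
      case True
      then obtain i where "?far i (k $ i)" ..
      then show ?thesis
        using w member_le_sum[of i UNIV "\<lambda>i. if ?far i (k $ i) then ?w k else 0"] by auto
    next
      case False
      then show ?thesis by (simp add: sum_nonneg)
    qed
  qed
  also have "\<dots> = (\<Sum>i\<in>UNIV. \<Sum>k | k \<in> Lambda a b n \<and> ?far i (k $ i). ?w k)"
    by (subst sum.swap) (simp only: sum.inter_filter[OF finite_Lambda])
  also have "\<dots> \<le> (\<Sum>i\<in>(UNIV::'d set). 2 * (1 - \<eta> (T - 1)))"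
    by (rule sum_mono) (rule coord)
  finally show ?thesis by simp
qed

section \<open>Node distances and weighted averages\<close>

text \<open>Over the denominator \<open>n + \<beta>\<close>, the error in a coordinate is the grid
  error \<open>k - n s\<close> plus the shift \<open>\<alpha> - \<beta> s\<close>. The shift is
  bounded, so it costs only a multiple of \<open>1/n\<close>. The factor \<open>CARD('d)\<close>
  comes from the l1 norm.\<close>

lemma stancu_node_dist_le:
  fixes s :: "real ^ 'd"
  assumes "0 < n" "0 \<le> \<alpha>" "0 \<le> \<beta>" "norm s \<le> B"
    and near: "\<And>i. \<bar>real n * s $ i - of_int (k $ i)\<bar> \<le> \<delta> * real n"
  shows "dist (stancu_node \<alpha> \<beta> n k) s \<le> real CARD('d) * (\<delta> + (\<alpha> + \<beta> * B) / real n)"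
proof -
  have "\<bar>stancu_node \<alpha> \<beta> n k $ i - s $ i\<bar> \<le> \<delta> + (\<alpha> + \<beta> * B) / real n" for i
  proof -
    have "\<bar>s $ i\<bar> \<le> B"
      using component_le_norm_cart[of s i] assms(4) by linarith
    then have "\<beta> * \<bar>s $ i\<bar> \<le> \<beta> * B"
      using assms(3) by (rule mult_left_mono)
    then have "\<bar>\<alpha> - \<beta> * s $ i\<bar> \<le> \<alpha> + \<beta> * B"
      using assms(2,3) abs_triangle_ineq4[of \<alpha> "\<beta> * s $ i"] by (simp add: abs_mult)
    then have "\<bar>(of_int (k $ i) - real n * s $ i) + (\<alpha> - \<beta> * s $ i)\<bar> \<le> \<delta> * real n + (\<alpha> + \<beta> * B)"
      using near[of i] by linarith
    moreover have "stancu_node \<alpha> \<beta> n k $ i - s $ i =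
        ((of_int (k $ i) - real n * s $ i) + (\<alpha> - \<beta> * s $ i)) / (real n + \<beta>)"
      using assms(1,3) by (simp add: stancu_node_def field_simps add_nonneg_eq_0_iff)
    moreover have "0 < real n + \<beta>"
      using assms(1,3) by simp
    ultimately have "\<bar>stancu_node \<alpha> \<beta> n k $ i - s $ i\<bar> \<le> (\<delta> * real n + (\<alpha> + \<beta> * B)) / (real n + \<beta>)"
      by (simp add: divide_right_mono)
    \<comment> \<open>Shrinking the denominator requires a nonnegative numerator; it is nonnegative
      because it dominates an absolute value.\<close>
    also have "\<dots> \<le> (\<delta> * real n + (\<alpha> + \<beta> * B)) / real n"
      using assms(1,3) \<open>0 < real n + \<beta>\<close>
        \<open>\<bar>(of_int (k $ i) - real n * s $ i) + (\<alpha> - \<beta> * s $ i)\<bar> \<le> _\<close>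
      by (intro divide_left_mono) auto
    also have "\<dots> = \<delta> + (\<alpha> + \<beta> * B) / real n"
      using assms(1) by (simp add: field_simps)
    finally show ?thesis .
  qed
  then have "(\<Sum>i\<in>UNIV. \<bar>(stancu_node \<alpha> \<beta> n k - s) $ i\<bar>) \<le> (\<Sum>i\<in>(UNIV::'d set). \<delta> + (\<alpha> + \<beta> * B) / real n)"
    by (intro sum_mono) simp
  with norm_le_l1_cart[of "stancu_node \<alpha> \<beta> n k - s"] show ?thesis
    by (simp add: dist_norm)
qed

text \<open>Subtracting \<open>y\<close> inside the average leaves deviations that are at most
  \<open>e\<close> off \<open>P\<close> and at most \<open>M\<close> on \<open>P\<close>, where the
  weight is at most \<open>\<tau>\<close>. The lower bound \<open>c\<close> then replaces the
  denominator in the second contribution.\<close>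

lemma abs_weighted_average_diff_le:
  fixes w h :: "'a \<Rightarrow> real"
  assumes "finite A" "\<And>k. k \<in> A \<Longrightarrow> 0 \<le> w k" "0 < c" "c \<le> sum w A" "0 \<le> e" "0 \<le> M"
    and "\<And>k. k \<in> A \<Longrightarrow> \<not> P k \<Longrightarrow> \<bar>h k - y\<bar> \<le> e"
    and "\<And>k. k \<in> A \<Longrightarrow> \<bar>h k - y\<bar> \<le> M"
    and "(\<Sum>k | k \<in> A \<and> P k. w k) \<le> \<tau>"
  shows "\<bar>(\<Sum>k\<in>A. w k * h k) / sum w A - y\<bar> \<le> e + M * \<tau> / c"
proof -
  let ?D = "sum w A"
  have D: "0 < ?D" using assms(3,4) by linarith
  have eq: "(\<Sum>k\<in>A. w k * h k) / ?D - y = (\<Sum>k\<in>A. w k * (h k - y)) / ?D"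
    using D by (simp add: right_diff_distrib sum_subtractf sum_distrib_right[symmetric] diff_divide_distrib)
  have "\<bar>\<Sum>k\<in>A. w k * (h k - y)\<bar> \<le> (\<Sum>k\<in>A. e * w k + (if P k then M * w k else 0))"
  proof (rule order_trans[OF sum_abs], rule sum_mono)
    fix k assume k: "k \<in> A"
    have "\<bar>h k - y\<bar> \<le> e + (if P k then M else 0)"
      using assms(5,7,8) k by (cases "P k") fastforce+
    from mult_left_mono[OF this assms(2)[OF k]]
    show "\<bar>w k * (h k - y)\<bar> \<le> e * w k + (if P k then M * w k else 0)"
      using assms(2)[OF k] by (cases "P k") (auto simp: abs_mult distrib_left mult.commute)
  qed
  also have "\<dots> = e * ?D + M * (\<Sum>k | k \<in> A \<and> P k. w k)"
    using assms(1) by (simp add: sum.distrib sum_distrib_left sum.inter_filter[symmetric])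
  also have "\<dots> \<le> e * ?D + M * \<tau>"
    using assms(6,9) by (intro add_left_mono mult_left_mono)
  finally have num: "\<bar>\<Sum>k\<in>A. w k * (h k - y)\<bar> \<le> e * ?D + M * \<tau>" .
  \<comment> \<open>The sign of \<open>M * \<tau>\<close> matters when the denominator is lowered to
    \<open>c\<close>.\<close>
  have "0 \<le> (\<Sum>k | k \<in> A \<and> P k. w k)"
    using assms(2) by (auto intro: sum_nonneg)
  then have "0 \<le> M * \<tau>"
    using assms(6,9) by simp
  then have "M * \<tau> / ?D \<le> M * \<tau> / c"
    using assms(3,4) D by (intro divide_left_mono) auto
  moreover have "\<bar>\<Sum>k\<in>A. w k * (h k - y)\<bar> / ?D \<le> e + M * \<tau> / ?D"
    using num D by (simp add: field_simps)
  ultimately show ?thesis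
    using D by (simp add: eq)
qed

section \<open>Uniform convergence on the box\<close>

theorem theorem3p4:
  fixes \<eta> :: "real \<Rightarrow> real" and \<alpha> \<beta> :: real
    and a b :: "real ^ 'd" and f g :: "real ^ 'd \<Rightarrow> real"
  assumes "sigmoidal \<eta>" and "mono \<eta>" and "\<eta> 1 < 1"
    and "\<forall>s. \<eta> (- s) - 1/2 = - (\<eta> s - 1/2)"
    and "C2_on_reals \<eta>" and "concave_on {0..} \<eta>"
    and "\<exists>\<rho>>0. \<eta> \<in> O[at_bot](\<lambda>s. \<bar>s\<bar> powr (- 1 - \<rho>))"
    and "0 \<le> \<alpha>" and "\<alpha> \<le> \<beta>"
    and "\<forall>i. a $ i < b $ i"
    and "continuous_on (cbox a b) f"
    and "stancu_extension \<alpha> \<beta> a b f g"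
  shows "uniform_limit (cbox a b) (\<lambda>n. stancu_nn \<eta> \<alpha> \<beta> a b n g) f sequentially"
proof (rule uniform_limitI)
  fix e :: real assume "0 < e"
  have sym: "\<eta> (- s) = 1 - \<eta> s" for s
    using assms(4)[rule_format, of s] by (simp add: field_simps)
  have half: "1/2 < \<eta> 1"
    using sym[of 0] by (intro half_less_eta_1 assms(1,6)) simp
  define c where "c = ((\<eta> 1 - 1/2) / 2) ^ CARD('d)"
  have c: "0 < c" using half by (simp add: c_def)
  obtain V where int: "cbox a b \<subseteq> interior V"
    and V': "\<forall>n\<ge>1. \<forall>k\<in>Lambda a b n. stancu_node \<alpha> \<beta> n k \<in> V" "\<forall>s\<in>cbox a b. g s = f s"
    and V: "continuous_on V g" "bounded (g ` V)"
    using assms(12) unfolding stancu_extension_def by (elim exE conjE)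
  have sub: "cbox a b \<subseteq> V"
    using int interior_subset by (rule subset_trans)
  obtain M where M: "0 < M" "\<And>x. x \<in> V \<Longrightarrow> \<bar>g x\<bar> \<le> M"
    using V(2) unfolding bounded_pos by auto
  obtain B where B: "\<And>s. s \<in> cbox a b \<Longrightarrow> norm s \<le> B"
    using bounded_cbox[of a b] unfolding bounded_iff by auto
  obtain r where r: "0 < r" "\<And>s x. s \<in> cbox a b \<Longrightarrow> x \<in> V \<Longrightarrow> dist x s < r \<Longrightarrow> dist (g x) (g s) < e/2"
    using compact_uniformly_continuous_near[OF compact_cbox sub V(1), of "e/2"] \<open>0 < e\<close> by auto
  \<comment> \<open>After multiplication by \<open>CARD('d)\<close> in the node estimate,
    \<open>\<delta>\<close> uses up \<open>r/2\<close>; the other half absorbs the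
    \<open>1/n\<close> term for large \<open>n\<close>.\<close>
  define \<delta> where "\<delta> = r / (2 * real CARD('d))"
  have \<delta>: "0 < \<delta>" using r(1) by (simp add: \<delta>_def)
  define \<tau> where "\<tau> n = real CARD('d) * (2 * (1 - \<eta> (\<delta> * real n - 1)))" for n

  have "((\<lambda>n. \<eta> (\<delta> * real n - 1)) \<longlongrightarrow> 1) sequentially"
  proof (rule filterlim_compose[of \<eta>])
    show "(\<eta> \<longlongrightarrow> 1) at_top" using assms(1) by (simp add: sigmoidal_def)
    show "filterlim (\<lambda>n. \<delta> * real n - 1) at_top sequentially"
      using filterlim_tendsto_add_at_top[OF tendsto_const[of "- 1"]
          filterlim_tendsto_pos_mult_at_top[OF tendsto_const \<delta> filterlim_real_sequentially]]
      by simp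
  qed
  \<comment> \<open>The limit is \<open>0\<close>, left unevaluated in the shape that
    \<open>tendsto_intros\<close> produces.\<close>
  then have "((\<lambda>n. 2 * M * \<tau> n / c) \<longlongrightarrow> 2 * M * (real CARD('d) * (2 * (1 - 1))) / c) sequentially"
    unfolding \<tau>_def using c by (intro tendsto_intros) auto
  then have ev1: "eventually (\<lambda>n. 2 * M * \<tau> n / c < e/2) sequentially"
    using \<open>0 < e\<close> by (intro order_tendstoD(2)) auto
  have "((\<lambda>n. real CARD('d) * (\<delta> + (\<alpha> + \<beta> * B) / real n)) \<longlongrightarrow> real CARD('d) * (\<delta> + 0)) sequentially"
    by (intro tendsto_intros lim_const_over_n)
  then have ev2: "eventually (\<lambda>n. real CARD('d) * (\<delta> + (\<alpha> + \<beta> * B) / real n) < r) sequentially"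
    using r(1) by (intro order_tendstoD(2)[where y = "real CARD('d) * (\<delta> + 0)"]) (simp_all add: \<delta>_def)
  have "eventually (\<lambda>n. 1 \<le> real n * (b $ i - a $ i)) sequentially" for i
  proof -
    have "0 < b $ i - a $ i" using assms(10) by simp
    then have "filterlim (\<lambda>n. real n * (b $ i - a $ i)) at_top sequentially"
      by (intro filterlim_at_top_mult_tendsto_pos[OF tendsto_const] filterlim_real_sequentially)
    then show ?thesis by (simp add: filterlim_at_top)
  qed
  then have ev3: "eventually (\<lambda>n. \<forall>i. 1 \<le> real n * (b $ i - a $ i)) sequentially"
    by (simp add: eventually_all_finite)
  show "\<forall>\<^sub>F n in sequentially. \<forall>s\<in>cbox a b. dist (stancu_nn \<eta> \<alpha> \<beta> a b n g s) (f s) < e"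
    \<comment> \<open>The index \<open>0\<close> is excluded because \<open>stancu_extension\<close>
      places nodes in \<open>V\<close> only from \<open>n = 1\<close> on.\<close>
    using ev1 ev2 ev3 eventually_ge_at_top[of 1]
  proof eventually_elim
    case (elim n)
    show ?case
    proof
      fix s assume s: "s \<in> cbox a b"
      let ?P = "\<lambda>k. \<exists>i. \<delta> * real n < \<bar>real n * s $ i - of_int (k $ i)\<bar>"
      \<comment> \<open>The comparison value is \<open>g s\<close>, which equals \<open>f s\<close>
        on the box; the far deviation \<open>2 * M\<close> bounds two values of \<open>g\<close> on
        \<open>V\<close>.\<close>
      have "\<bar>stancu_nn \<eta> \<alpha> \<beta> a b n g s - g s\<bar> \<le> e/2 + 2 * M * \<tau> n / c"
        unfolding stancu_nn_def
      proof (rule abs_weighted_average_diff_le[where P = ?P])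
        show "c \<le> (\<Sum>k\<in>Lambda a b n. stancu_weight \<eta> n k s)"
          unfolding c_def using half elim(3) s
          by (intro stancu_denominator_lower_bound assms(2) sym) auto
        show "(\<Sum>k | k \<in> Lambda a b n \<and> ?P k. stancu_weight \<eta> n k s) \<le> \<tau> n"
          unfolding \<tau>_def by (rule stancu_weight_far_sum[OF assms(1,2) sym, where T = "\<delta> * real n"])
        fix k assume k: "k \<in> Lambda a b n"
        have node: "stancu_node \<alpha> \<beta> n k \<in> V" using V'(1) k elim(4) by simp
        show "\<bar>g (stancu_node \<alpha> \<beta> n k) - g s\<bar> \<le> 2 * M"
          using M(2)[OF node] M(2)[of s] sub s by fastforce
        assume "\<not> ?P k"
        then have "dist (stancu_node \<alpha> \<beta> n k) s \<le> real CARD('d) * (\<delta> + (\<alpha> + \<beta> * B) / real n)"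
          using elim(4) assms(8,9) B[OF s] by (intro stancu_node_dist_le) (auto simp: not_less)
        with elim(2) have "dist (stancu_node \<alpha> \<beta> n k) s < r" by linarith
        from r(2)[OF s node this] show "\<bar>g (stancu_node \<alpha> \<beta> n k) - g s\<bar> \<le> e/2"
          by (simp add: dist_real_def)
      qed (use \<open>0 < e\<close> M(1) c in \<open>auto intro: finite_Lambda stancu_weight_nonneg assms(2)\<close>)
      with elim(1) V'(2) s show "dist (stancu_nn \<eta> \<alpha> \<beta> a b n g s) (f s) < e"
        by (simp add: dist_real_def)
    qed
  qed
qed

end
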